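(* Let $\mathcal{H}$ be a hypergraph with no isolated vertices. If $|e|\leq 2$ for all $e\in E(\mathcal{H})$, then $\gamma_i(\mathcal{H})=\gamma_{si}(\mathcal{H})$, where $\gamma_i(\mathcal{H})$ is the independence domination number and $\gamma_{si}(\mathcal{H})$ is the strong independence domination number of $\mathcal{H}$.
   Context: A hypergraph $\mathcal{H}$ is a pair $(V(\mathcal{H}),E(\mathcal{H}))$ with $V(\mathcal{H})$ a finite set and $E(\mathcal{H})$ a family of subsets of $V(\mathcal{H})$ (edges, taken nonempty so that independent sets exist). A vertex $w$ is a neighbour of $v$ if there is $e\in E(\mathcal{H})$ with $\{v,w\}\subseteq e$; $N(v)$ is the set of neighbours of $v$, and $N(A)=\bigcup_{v\in A}N(v)$. A vertex $w$ is isolated if $N(w)=\emptyset$. A set $\mathcal{I}\subseteq V(\mathcal{H})$ is independent if $e\not\subseteq\mathcal{I}$ for all $e\in E(\mathcal{H})$; it is strongly independent if it is independent and every edge of $\mathcal{H}$ contains at most one vertex of $\mathcal{I}$. For $A\subseteq V(\mathcal{H})$, a set $W\subseteq V(\mathcal{H})\setminus A$ is a dominating set of $A$ if $A\subseteq N(W)$, and $\gamma_A(\mathcal{H})=\min\{|W|:W\text{ is a dominating set of }A\}$. The independence domination number is $\gamma_i(\mathcal{H})=\max\{\gamma_{\mathcal{I}}(\mathcal{H}):\mathcal{I}\text{ independent}\}$. A set $B\subseteq V(\mathcal{H})$ strongly totally dominates a vertex $v$ if there is $B'\subseteq B\setminus\{v\}$ with $B'\cup\{v\}\in E(\mathcal{H})$;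 $B$ strongly dominates $W\subseteq V(\mathcal{H})$ if it strongly totally dominates every vertex of $W$. Put $\gamma(\mathcal{H};W)=\min\{|B|:B\subseteq V(\mathcal{H}),\ B\text{ strongly dominates }W\}$. The strong independence domination number is $\gamma_{si}(\mathcal{H})=\max\{\gamma(\mathcal{H};\mathcal{I}):\mathcal{I}\text{ is a strongly independent set of }\mathcal{H}\}$. *)

theory Defs
  imports Main
begin

definition hypergraph :: "'a set \<Rightarrow> 'a set set \<Rightarrow> bool" where
  "hypergraph V E \<longleftrightarrow> finite V \<and> (\<forall>e\<in>E. e \<subseteq> V \<and> e \<noteq> {})"

text \<open>
  Literal reading: \<open>w = v\<close> is allowed, so a vertex is its own neighbour as soon as it lies
  in some edge, and the isolated vertices are those lying in no edge. Domination is not affected,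
  since a dominating set of \<open>A\<close> is disjoint from \<open>A\<close>.
\<close>

definition neighbours :: "'a set \<Rightarrow> 'a set set \<Rightarrow> 'a \<Rightarrow> 'a set" where
  "neighbours V E v = {w \<in> V. \<exists>e\<in>E. {v, w} \<subseteq> e}"

definition neighbours_set :: "'a set \<Rightarrow> 'a set set \<Rightarrow> 'a set \<Rightarrow> 'a set" where
  "neighbours_set V E A = (\<Union>v\<in>A. neighbours V E v)"

definition isolated :: "'a set \<Rightarrow> 'a set set \<Rightarrow> 'a \<Rightarrow> bool" where
  "isolated V E w \<longleftrightarrow> w \<in> V \<and> neighbours V E w = {}"

definition independent :: "'a set \<Rightarrow> 'a set set \<Rightarrow> 'a set \<Rightarrow> bool" where
  "independent V E I \<longleftrightarrow> I \<subseteq> V \<and> (\<forall>e\<in>E. \<not> e \<subseteq> I)"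

definition strongly_independent :: "'a set \<Rightarrow> 'a set set \<Rightarrow> 'a set \<Rightarrow> bool" where
  "strongly_independent V E I \<longleftrightarrow> independent V E I \<and> (\<forall>e\<in>E. card (e \<inter> I) \<le> 1)"

definition dominating_set :: "'a set \<Rightarrow> 'a set set \<Rightarrow> 'a set \<Rightarrow> 'a set \<Rightarrow> bool" where
  "dominating_set V E A W \<longleftrightarrow> W \<subseteq> V - A \<and> A \<subseteq> neighbours_set V E W"

text \<open>
  All minima and maxima below are over sets of natural numbers that are finite because \<open>V\<close> is.
  The two minima are over nonempty sets whenever the hypergraph has no isolated vertices and the
  dominated set is independent: then \<open>V - I\<close> dominates \<open>I\<close>, and \<open>V\<close> strongly
  dominates \<open>I\<close>. The maxima are over nonempty sets because edges are nonempty, which makes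
  the empty set (strongly) independent. Outside these cases the values are unspecified.
\<close>

definition domination_number :: "'a set \<Rightarrow> 'a set set \<Rightarrow> 'a set \<Rightarrow> nat" where
  "domination_number V E A = Min {card W | W. dominating_set V E A W}"

definition independence_domination_number :: "'a set \<Rightarrow> 'a set set \<Rightarrow> nat" where
  "independence_domination_number V E = Max {domination_number V E I | I. independent V E I}"

definition strongly_totally_dominates ::
    "'a set set \<Rightarrow> 'a set \<Rightarrow> 'a \<Rightarrow> bool" where
  "strongly_totally_dominates E B v \<longleftrightarrow> (\<exists>B'. B' \<subseteq> B - {v} \<and> B' \<union> {v} \<in> E)"

definition strongly_dominates :: "'a set set \<Rightarrow> 'a set \<Rightarrow> 'a set \<Rightarrow> bool" where
  "strongly_dominates E B W \<longleftrightarrow> (\<forall>v\<in>W. strongly_totally_dominates E B v)"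

definition strong_domination_number :: "'a set \<Rightarrow> 'a set set \<Rightarrow> 'a set \<Rightarrow> nat" where
  "strong_domination_number V E W = Min {card B | B. B \<subseteq> V \<and> strongly_dominates E B W}"

definition strong_independence_domination_number :: "'a set \<Rightarrow> 'a set set \<Rightarrow> nat" where
  "strong_independence_domination_number V E =
     Max {strong_domination_number V E I | I. strongly_independent V E I}"

end

theory Submission
  imports Defs
begin

text \<open>
  With edges of size at most two, an edge that is not contained in \<open>I\<close> meets \<open>I\<close> in at most one
  vertex, so independent and strongly independent sets coincide. For such a set \<open>I\<close>, every
  dominating set strongly dominates \<open>I\<close>, while a strongly dominating set \<open>B\<close> can be shrunk to the
  dominating set \<open>B - I\<close>: the edge witnessing that \<open>v \<in> I\<close> is strongly dominated leaves \<open>I\<close>,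
  and does so at a vertex of \<open>B\<close>. Hence the two minima agree for each \<open>I\<close>.
\<close>

text \<open>Serves to compare two minimisation problems when one has fewer competitors, but each
  competitor of the larger one can be replaced by one of the smaller at no extra cost.\<close>

lemma Min_eq_of_cofinal_subset:
  fixes A S :: "'b::linorder set"
  assumes "finite S" and "A \<subseteq> S" and "\<And>s. s \<in> S \<Longrightarrow> \<exists>a\<in>A. a \<le> s"
  shows "Min A = Min S"
proof (cases "A = {}")
  case True
  \<comment> \<open>Both sides are then the same unspecified value \<open>Min {}\<close>.\<close>
  then have "S = {}" using assms(3) by fast
  with True show ?thesis by simp
next
  case False
  have "finite A" using assms(2,1) by (rule finite_subset)
  have "S \<noteq> {}" using False assms(2) by blast
  then obtain a where "a \<in> A" "a \<le> Min S" using assms(3)[OF Min_in[OF assms(1)]] by auto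
  then have "Min A \<le> Min S" using Min_le[OF \<open>finite A\<close>, of a] by simp
  then show ?thesis using Min_antimono[OF assms(2) False assms(1)] by simp
qed

lemma finite_edge:
  assumes "hypergraph V E" and "e \<in> E"
  shows "finite e"
proof (rule finite_subset)
  show "e \<subseteq> V" "finite V" using assms unfolding hypergraph_def by auto
qed

lemma strongly_independent_iff_independent:
  assumes "hypergraph V E" and "\<forall>e\<in>E. card e \<le> 2"
  shows "strongly_independent V E I \<longleftrightarrow> independent V E I"
proof -
  have "card (e \<inter> I) \<le> 1" if "independent V E I" "e \<in> E" for e
  proof -
    have "finite e" using assms(1) that(2) by (rule finite_edge)
    moreover have "e \<inter> I \<subset> e"
      using that unfolding independent_def by blast
    ultimately have "card (e \<inter> I) < card e" by (rule psubset_card_mono)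
    then show ?thesis using assms(2) that(2) by fastforce
  qed
  then show ?thesis unfolding strongly_independent_def by blast
qed

text \<open>A dominator \<open>w\<close> of \<open>v\<close> lies outside \<open>A\<close>, so it
  differs from \<open>v\<close>, and an edge with at most two vertices that contains both is exactly
  \<open>{w, v}\<close>. Thus \<open>{w}\<close> is the required \<open>B'\<close>.\<close>

lemma dominating_set_imp_strongly_dominates:
  assumes "hypergraph V E" and "\<forall>e\<in>E. card e \<le> 2" and "dominating_set V E A W"
  shows "strongly_dominates E W A"
  unfolding strongly_dominates_def strongly_totally_dominates_def
proof
  fix v assume "v \<in> A"
  then obtain w e where w: "w \<in> W" "e \<in> E" "{w, v} \<subseteq> e"
    using assms(3) unfolding dominating_set_def neighbours_set_def neighbours_def by blast
  \<comment> \<open>\<open>neighbours\<close> lets a vertex be its own neighbour; disjointness of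
    \<open>W\<close> and \<open>A\<close> excludes this here.\<close>
  have "w \<noteq> v" using \<open>v \<in> A\<close> w(1) assms(3) unfolding dominating_set_def by blast
  moreover have "finite e" using assms(1) w(2) by (rule finite_edge)
  ultimately have "{w, v} = e"
    using w(2,3) assms(2) by (intro card_seteq) auto
  then have "{w} \<union> {v} \<in> E" using w(2) by (simp add: insert_commute)
  then show "\<exists>B'\<subseteq>W - {v}. B' \<union> {v} \<in> E"
    using w(1) \<open>w \<noteq> v\<close> by (intro exI[of _ "{w}"]) simp
qed

lemma strongly_dominates_imp_dominating_set:
  assumes "independent V E I" and "B \<subseteq> V" and "strongly_dominates E B I"
  shows "dominating_set V E I (B - I)"
proof -
  have "v \<in> neighbours_set V E (B - I)" if "v \<in> I" for v
  proof -
    have "strongly_totally_dominates E B v"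
      using assms(3) that unfolding strongly_dominates_def by simp
    then obtain B' where B': "B' \<subseteq> B - {v}" "B' \<union> {v} \<in> E"
      unfolding strongly_totally_dominates_def by (elim exE conjE)
    \<comment> \<open>Since \<open>v\<close> is in \<open>I\<close>, the vertex at which this edge
      leaves \<open>I\<close> must belong to \<open>B'\<close>, hence to
      \<open>B - I\<close>.\<close>
    have "\<not> B' \<union> {v} \<subseteq> I"
      using assms(1) B'(2) unfolding independent_def by meson
    then obtain w where w: "w \<in> B'" "w \<notin> I" using \<open>v \<in> I\<close> by auto
    have "v \<in> V" using assms(1) that unfolding independent_def by auto
    then have "v \<in> neighbours V E w"
      using B'(2) w(1) unfolding neighbours_def by (simp add: bexI[of _ "B' \<union> {v}"])
    moreover have "w \<in> B - I" using w B'(1) by auto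
    ultimately show ?thesis unfolding neighbours_set_def by auto
  qed
  then show ?thesis using assms(2) unfolding dominating_set_def by auto
qed

lemma domination_number_eq_strong_domination_number:
  assumes "hypergraph V E" and "\<forall>e\<in>E. card e \<le> 2" and "independent V E I"
  shows "domination_number V E I = strong_domination_number V E I"
  unfolding domination_number_def strong_domination_number_def
\<comment> \<open>The sizes of dominating sets form the smaller family; passing from
  \<open>B\<close> to \<open>B - I\<close> gives cofinality.\<close>
proof (rule Min_eq_of_cofinal_subset)
  have "finite V" using assms(1) unfolding hypergraph_def by blast
  then show "finite {card B |B. B \<subseteq> V \<and> strongly_dominates E B I}"
    by simp
  show "{card W |W. dominating_set V E I W} \<subseteq> {card B |B. B \<subseteq> V \<and> strongly_dominates E B I}"
    using dominating_set_imp_strongly_dominates[OF assms(1,2)]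
    unfolding dominating_set_def by blast
  fix s assume "s \<in> {card B |B. B \<subseteq> V \<and> strongly_dominates E B I}"
  then obtain B where B: "s = card B" "B \<subseteq> V" "strongly_dominates E B I" by blast
  moreover have "card (B - I) \<le> card B"
    using finite_subset[OF B(2) \<open>finite V\<close>] by (intro card_mono) auto
  ultimately show "\<exists>a\<in>{card W |W. dominating_set V E I W}. a \<le> s"
    using strongly_dominates_imp_dominating_set[OF assms(3)] by blast
qed

theorem lemma2p11:
  fixes V :: "'a set" and E :: "'a set set"
  assumes "hypergraph V E"
    and "\<forall>w\<in>V. \<not> isolated V E w"
    and "\<forall>e\<in>E. card e \<le> 2"
  shows "independence_domination_number V E = strong_independence_domination_number V E"
proof -
  have "{domination_number V E I |I. independent V E I} =
      {strong_domination_number V E I |I. strongly_independent V E I}"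
    \<comment> \<open>Both maxima now range over the same sets \<open>I\<close>, so it suffices that
      the two numbers agree for each \<open>I\<close>.\<close>
    unfolding strongly_independent_iff_independent[OF assms(1,3)] setcompr_eq_image
    using domination_number_eq_strong_domination_number[OF assms(1,3)]
    by (intro image_cong) auto
  then show ?thesis
    unfolding independence_domination_number_def strong_independence_domination_number_def
    by simp
qed

end
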